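(* There are infinitely many pairs of different tetrahedral numbers whose product is the square of an integer; i.e., there are infinitely many pairs of positive integers $x \neq y$ such that $T_x T_y = z^2$ for some integer $z$.
   Context: $T_n = \frac{n(n+1)(n+2)}{6}$ denotes the $n$-th tetrahedral number. *)

theory Defs
  imports Complex_Main
begin

definition tetrahedral :: "nat \<Rightarrow> nat" where
  "tetrahedral n = n * (n + 1) * (n + 2) div 6"

text \<open>The natural-number division in the definition is exact.\<close>

lemma six_times_tetrahedral: "6 * tetrahedral n = n * (n + 1) * (n + 2)"
proof -
  have "6 dvd n * (n + 1) * (n + 2)"
  proof (induction n)
    case (Suc n)
    have "even ((n + 1) * (n + 2))" by simp
    then obtain k where k: "(n + 1) * (n + 2) = 2 * k" by (rule evenE)
    have "Suc n * (Suc n + 1) * (Suc n + 2) = n * (n + 1) * (n + 2) + 3 * ((n + 1) * (n + 2))"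
      by (simp add: algebra_simps)
    also have "\<dots> = n * (n + 1) * (n + 2) + 6 * k" using k by simp
    finally show ?case using Suc by (metis dvd_add dvd_triv_left)
  qed simp
  then show ?thesis unfolding tetrahedral_def by simp
qed

end

theory Submission
  imports Defs "HOL-Library.Infinite_Set"
begin

text \<open>
  For y = 2 x the product of the tetrahedral numbers is, up to square factors, (2 x + 1) (x + 2).
  Requiring this to be 9 v^2 is, with a = (4 x + 5) / 3, the Pell equation a^2 - 8 v^2 = 1
  restricted to 3 a \<equiv> 1 (mod 4).  Starting from x = v = 1, multiplication by the unit
  17 + 6 sqrt 8, which preserves this congruence, produces infinitely many solutions.
\<close>

lemma tetrahedral_mult_double:
  assumes "(2 * x + 1) * (x + 2) = 9 * v\<^sup>2"
  shows "tetrahedral x * tetrahedral (2 * x) = (x * (x + 1) * v)\<^sup>2"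
proof -
  have "36 * (tetrahedral x * tetrahedral (2 * x))
      = (6 * tetrahedral x) * (6 * tetrahedral (2 * x))"
    by simp
  also have "\<dots> = 4 * (x * (x + 1))\<^sup>2 * ((2 * x + 1) * (x + 2))"
    unfolding six_times_tetrahedral by (simp add: power2_eq_square algebra_simps)
  \<comment> \<open>The 9 in the hypothesis joins the 4 to give exactly 36, leaving an integral
    root.\<close>
  also have "\<dots> = 36 * (x * (x + 1) * v)\<^sup>2"
    unfolding assms by (simp add: power_mult_distrib)
  finally show ?thesis by simp
qed

lemma ex_large_Pell_solution:
  "\<exists>x v :: nat. x > n \<and> (2 * x + 1) * (x + 2) = 9 * v\<^sup>2"
proof (induction n)
  case 0
  show ?case by (rule exI[of _ 1], rule exI[of _ 1]) simp
next
  case (Suc n)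
  then obtain x v :: nat where "x > n" and eq: "(2 * x + 1) * (x + 2) = 9 * v\<^sup>2"
    by blast
  \<comment> \<open>From a' = 17 a + 48 v and v' = 6 a + 17 v, with a = (4 x + 5) / 3 and x' = (3 a'
    - 5) / 4.\<close>
  define x' v' where "x' = 17 * x + 36 * v + 20" and "v' = 8 * x + 17 * v + 10"
  \<comment> \<open>Invariance of a^2 - 8 v^2 under a unit of norm 1, arranged without subtraction
    on \<open>nat\<close>.\<close>
  have "(2 * x' + 1) * (x' + 2) + 9 * v\<^sup>2 = 9 * v'\<^sup>2 + (2 * x + 1) * (x + 2)"
    unfolding x'_def v'_def by (simp add: power2_eq_square algebra_simps)
  with eq have "(2 * x' + 1) * (x' + 2) = 9 * v'\<^sup>2" by simp
  moreover have "x' > Suc n" using \<open>x > n\<close> unfolding x'_def by simp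
  ultimately show ?case by blast
qed

theorem theorem5p6:
  shows "infinite {(x :: nat, y :: nat). x > 0 \<and> y > 0 \<and> x \<noteq> y \<and>
    (\<exists>z :: int. int (tetrahedral x) * int (tetrahedral y) = z ^ 2)}"
  (is "infinite ?S")
proof -
  \<comment> \<open>Projecting to first coordinates reduces infinitude to unboundedness in
    \<open>nat\<close>.\<close>
  have "\<exists>x > n. x \<in> fst ` ?S" for n
  proof -
    obtain x v where "x > n" and "(2 * x + 1) * (x + 2) = 9 * v\<^sup>2"
      using ex_large_Pell_solution by blast
    then have "int (tetrahedral x) * int (tetrahedral (2 * x)) = (int (x * (x + 1) * v)) ^ 2"
      using tetrahedral_mult_double by (metis of_nat_mult of_nat_power)
    then have "(x, 2 * x) \<in> ?S" using \<open>x > n\<close>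
      unfolding mem_Collect_eq case_prod_conv by (intro conjI exI) simp_all
    then have "fst (x, 2 * x) \<in> fst ` ?S" by (rule imageI)
    then show ?thesis using \<open>x > n\<close> unfolding fst_conv by blast
  qed
  then have "infinite (fst ` ?S)" unfolding infinite_nat_iff_unbounded by (intro allI)
  then show ?thesis by (rule contrapos_nn) (rule finite_imageI)
qed

end
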